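(* Let $K$ be a field of characteristic zero, let $R$ be a $0$-dimensional affine $K$-algebra, and let $(f_1,\dots,f_k)\in(R^\times)^k$. Perform the following steps. (1) Compute the maximal ideals $\mathfrak m_1,\dots,\mathfrak m_s$ of $R$. (2) For $i=1,\dots,s$ compute the exponent lattice $\Lambda_i\subseteq\mathbb Z^k$ of $(\overline f_1,\dots,\overline f_k)$, where $\overline f_j$ is the canonical image of $f_j$ in the field $R/\mathfrak m_i$. (3) For $i=1,\dots,k$ compute the decomposition $f_i=f_i^{\mathrm{sep}}+f_i^{\mathrm{nil}}$ into separable and nilpotent part. (4) For $i=1,\dots,k$ compute $\log(f_i(f_i^{\mathrm{sep}})^{-1})=\log\bigl(\sum_{j=0}^{m_i-1}f_i^{-j}(f_i^{\mathrm{nil}})^j\bigr)$, where $m_i$ is the nilpotency index of $f_i^{\mathrm{nil}}$. (5) Compute the solution space $M\subseteq\mathbb Z^k$ of the linear equation $$y_1\log(f_1(f_1^{\mathrm{sep}})^{-1})+\cdots+y_k\log(f_k(f_k^{\mathrm{sep}})^{-1})=0$$ in the additive group $\operatorname{Rad}(0)$, with integer unknowns $y_1,\dots,y_k$. (6) Return the lattice $M\cap\Lambda_1\cap\cdots\cap\Lambda_s$. Then the returned lattice is the exponent lattice of $(f_1,\dots,f_k)$ in $R$.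
   Context: For elements $f_1,\dots,f_k$ of a multiplicative abelian group, the exponent lattice of $(f_1,\dots,f_k)$ is $\{(a_1,\dots,a_k)\in\mathbb Z^k\mid f_1^{a_1}\cdots f_k^{a_k}=1\}$; for units of a ring $R$ the group is $R^\times$. The zero radical $\operatorname{Rad}(0)$ is the intersection of all maximal ideals of $R$ (its nilradical). An element of $R$ is separable if its minimal polynomial over $K$ has pairwise distinct roots in an algebraic closure; $R^{\mathrm{sep}}$ is the $K$-subalgebra of separable elements. Every $a\in R$ has a unique decomposition $a=a^{\mathrm{sep}}+a^{\mathrm{nil}}$ with $a^{\mathrm{sep}}\in R^{\mathrm{sep}}$ (separable part) and $a^{\mathrm{nil}}\in\operatorname{Rad}(0)$ (nilpotent part). The nilpotency index of a nilpotent $r$ is the smallest $m>0$ with $r^m=0$. With $m\in\mathbb N$ such that $\operatorname{Rad}(0)^m=0$, the map $\log:1+\operatorname{Rad}(0)\to\operatorname{Rad}(0)$ is $\log(1+v)=\sum_{i=1}^{m-1}(-1)^{i-1}\frac{v^i}{i}$, a group isomorphism from the multiplicative group $1+\operatorname{Rad}(0)$ to the additive group $\operatorname{Rad}(0)$. *)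

theory Defs
  imports
    "HOL-Algebra.Algebra"
    "HOL-Algebra.Algebraic_Closure_Type"
    "HOL-Library.Extended_Nat"
begin

text \<open>
  The \<open>K\<close>-algebra \<open>R\<close> is a commutative ring type (so \<open>0 \<noteq> 1\<close>) with a scalar multiplication by
  a field type. The view \<open>alg_ring\<close> of \<open>R\<close> as a ring record gives access to ideals, residue class
  rings and unit groups.
\<close>

abbreviation alg_ring :: "'r::comm_ring_1 ring"
  where "alg_ring \<equiv> ring_of_type_algebra"

locale K_algebra = vector_space scale
  for scale :: "'k::field \<Rightarrow> 'r::comm_ring_1 \<Rightarrow> 'r" +
  assumes scale_mult_left: "scale c (x * y) = scale c x * y"
begin

definition K_subalgebra :: "'r set \<Rightarrow> bool"
  where "K_subalgebra S \<longleftrightarrow> subspace S \<and> 1 \<in> S \<and> (\<forall>x\<in>S. \<forall>y\<in>S. x * y \<in> S)"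

end

locale affine_K_algebra = K_algebra +
  assumes finitely_generated: "\<exists>G. finite G \<and> K_subalgebra hull G = UNIV"

text \<open>The Krull dimension of a nonzero ring: the supremum of the lengths of chains of prime ideals.\<close>

definition krull_dim :: "('a, 'b) ring_scheme \<Rightarrow> enat"
  where "krull_dim R =
    Sup {enat n | n. \<exists>P :: nat \<Rightarrow> 'a set. (\<forall>i\<le>n. primeideal (P i) R) \<and> (\<forall>i<n. P i \<subset> P (Suc i))}"

definition zero_radical :: "('a, 'b) ring_scheme \<Rightarrow> 'a set"
  where "zero_radical R = \<Inter>{I. maximalideal I R}"

definition alg_eval :: "('k::field \<Rightarrow> 'r::comm_ring_1 \<Rightarrow> 'r) \<Rightarrow> 'k poly \<Rightarrow> 'r \<Rightarrow> 'r"
  where "alg_eval scale p a = poly (map_poly (\<lambda>c. scale c 1) p) a"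

definition is_minimal_poly :: "('k::field \<Rightarrow> 'r::comm_ring_1 \<Rightarrow> 'r) \<Rightarrow> 'r \<Rightarrow> 'k poly \<Rightarrow> bool"
  where "is_minimal_poly scale a p \<longleftrightarrow>
    lead_coeff p = 1 \<and> alg_eval scale p a = 0 \<and>
    (\<forall>q. q \<noteq> 0 \<and> alg_eval scale q a = 0 \<longrightarrow> degree p \<le> degree q)"

text \<open>\<^const>\<open>rsquarefree\<close> says that every root, here in the algebraic closure, is simple.\<close>

definition separable_elements :: "('k::field \<Rightarrow> 'r::comm_ring_1 \<Rightarrow> 'r) \<Rightarrow> 'r set"
  where "separable_elements scale =
    {a. \<exists>p. is_minimal_poly scale a p \<and> rsquarefree (map_poly to_ac p)}"

definition nilpotency_index :: "'r::comm_ring_1 \<Rightarrow> nat"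
  where "nilpotency_index r = (LEAST m. m > 0 \<and> r ^ m = 0)"

text \<open>The logarithm on \<open>1 + Rad(0)\<close>, where \<open>m\<close> is such that \<open>Rad(0)\<^sup>m = 0\<close>.\<close>

definition unipotent_log ::
    "('k::field \<Rightarrow> 'r::comm_ring_1 \<Rightarrow> 'r) \<Rightarrow> nat \<Rightarrow> 'r \<Rightarrow> 'r"
  where "unipotent_log scale m u =
    (\<Sum>i = 1..m - 1. scale ((-1) ^ (i - 1) / of_nat i) ((u - 1) ^ i))"

text \<open>\<open>\<int>\<^sup>k\<close> as the set of extensional functions on \<open>{1..k}\<close>.\<close>

abbreviation int_vecs :: "nat \<Rightarrow> (nat \<Rightarrow> int) set"
  where "int_vecs k \<equiv> {1..k} \<rightarrow>\<^sub>E UNIV"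

definition exponent_lattice ::
    "('g, 'b) monoid_scheme \<Rightarrow> nat \<Rightarrow> (nat \<Rightarrow> 'g) \<Rightarrow> (nat \<Rightarrow> int) set"
  where "exponent_lattice G k f =
    {a \<in> int_vecs k. (\<Otimes>\<^bsub>G\<^esub>i\<in>{1..k}. f i [^]\<^bsub>G\<^esub> a i) = \<one>\<^bsub>G\<^esub>}"

end

theory Submission
  imports Defs
begin

text \<open>
  Write \<open>N\<close> for the zero radical, \<open>s\<^sub>i\<close> for the separable part of \<open>f\<^sub>i\<close> and \<open>u\<^sub>i = f\<^sub>i / s\<^sub>i\<close>. Since \<open>f\<^sub>i\<close> is a
  unit and \<open>s\<^sub>i\<close> differs from it by a nilpotent element, \<open>s\<^sub>i\<close> is a unit, and the geometric series
  expands \<open>u\<^sub>i\<close> in powers of the nilpotent part (\<open>unit_minus_nilpotent\<close>); moreover \<open>u\<^sub>i \<in> 1 + N\<close>. For an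
  exponent vector \<open>a\<close>, let \<open>F\<close>, \<open>S\<close>, \<open>T\<close> be the products of the powers with exponents \<open>a\<^sub>i\<close> of the
  \<open>f\<^sub>i\<close>, the \<open>s\<^sub>i\<close> and the \<open>u\<^sub>i\<close>. Then \<open>F = S T\<close> is a multiplicative Jordan decomposition of \<open>F\<close>, and
  the two kinds of lattice detect its two factors:

  \<^item> The vector \<open>a\<close> lies in all \<open>\<Lambda>\<^sub>i\<close> if and only if \<open>F \<equiv> 1\<close> modulo every maximal ideal, that is,
    \<open>F - 1 \<in> N\<close> (\<open>exponent_lattice_Quot\<close>).
  \<^item> The truncated logarithm is additive on \<open>1 + N\<close> and has trivial kernel
    (\<open>trunc_log_add\<close>, \<open>trunc_log_eq_0_imp\<close>), so \<open>a \<in> M\<close> if and only if \<open>T = 1\<close>.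

  It remains to see that \<open>F = 1\<close> is equivalent to \<open>T = 1\<close> and \<open>F - 1 \<in> N\<close>. Both directions follow from
  the fact that \<open>S - 1 \<in> N\<close> implies \<open>S = 1\<close> (\<open>separable_power_product_eq_1\<close>).

  This fact says that separable elements generate a reduced algebra. Over an algebraically closed
  field it would hold because commuting diagonalizable operators are simultaneously
  diagonalizable, and a diagonalizable nilpotent operator is zero. Instead of extending scalars,
  the proof lets \<open>R\<close> act on the \<open>K\<close>-linear functionals \<open>R \<Rightarrow> K\<^sup>a\<^sup>c\<close> by \<open>(r\<phi>)(x) = \<phi>(rx)\<close>. The values
  make this a space over the algebraic closure, so the \<open>s\<^sub>i\<close> act diagonalizably, and the
  functionals separate the elements of \<open>R\<close>.
\<close>

section \<open>Truncated logarithms of unipotent elements\<close>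

lemma nilpotent_add:
  fixes x y :: "'a::comm_ring_1"
  assumes "x ^ m = 0" and "y ^ n = 0"
  shows "(x + y) ^ (m + n) = 0"
proof -
  have "of_nat ((m + n) choose k) * x ^ k * y ^ (m + n - k) = 0" if "k \<le> m + n" for k
  proof (cases "m \<le> k")
    case True
    then have "x ^ k = x ^ m * x ^ (k - m)"
      by (simp flip: power_add)
    then show ?thesis
      using assms by simp
  next
    case False
    then have "m + n - k = n + (m - k)"
      by simp
    then show ?thesis
      using assms by (simp add: power_add)
  qed
  then show ?thesis
    by (simp add: binomial_ring)
qed

lemma unipotent_inverse:
  fixes x :: "'a::comm_ring_1"
  assumes "x ^ n = 0"
  shows "(1 - x) * (\<Sum>j<n. x ^ j) = 1"
  using one_diff_power_eq[of x n] assms by simp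

lemma unipotent_mult_eq_0:
  fixes x :: "'a::comm_ring_1"
  assumes "x ^ n = 0" and "(1 - x) * y = 0"
  shows "y = 0"
proof -
  have "y = (1 - x) * (\<Sum>j<n. x ^ j) * y"
    using unipotent_inverse[OF assms(1)] by simp
  also have "\<dots> = (\<Sum>j<n. x ^ j) * ((1 - x) * y)"
    by (simp only: mult_ac)
  finally show ?thesis
    using assms(2) by simp
qed

text \<open>
  The coefficients are left abstract so that the same function serves in \<open>R\<close>, in \<open>R[t]\<close> and in
  \<open>R[[t]]\<close>. It is the logarithm when \<open>i c\<^sub>i = (-1)\<^sup>i\<^sup>-\<^sup>1\<close>, which is an equation that makes sense in
  a ring without a field of scalars.
\<close>

definition trunc_log :: "(nat \<Rightarrow> 'a::comm_ring_1) \<Rightarrow> nat \<Rightarrow> 'a \<Rightarrow> 'a"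
  where "trunc_log c n v = (\<Sum>i = 1..n - 1. c i * v ^ i)"

lemma trunc_log_mono:
  assumes "v ^ m = 0" and "m \<le> n"
  shows "trunc_log c n v = trunc_log c m v"
  unfolding trunc_log_def
proof (rule sum.mono_neutral_right)
  show "\<forall>i\<in>{1..n - 1} - {1..m - 1}. c i * v ^ i = 0"
  proof
    fix i assume "i \<in> {1..n - 1} - {1..m - 1}"
    then have "v ^ i = v ^ m * v ^ (i - m)"
      by (auto simp flip: power_add)
    then show "c i * v ^ i = 0"
      using assms by simp
  qed
qed (use assms in auto)

lemma trunc_log_0: "trunc_log c n 0 = 0"
  unfolding trunc_log_def by (intro sum.neutral) (auto simp: power_0_left)

lemma fps_of_poly_trunc_log:
  "fps_of_poly (trunc_log (\<lambda>i. [:c i:]) n p) = trunc_log (\<lambda>i. fps_const (c i)) n (fps_of_poly p)"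
  unfolding trunc_log_def
  by (simp only: fps_of_poly_sum fps_of_poly_mult fps_of_poly_power fps_of_poly_const)

lemma poly_trunc_log: "poly (trunc_log (\<lambda>i. [:c i:]) n p) x = trunc_log c n (poly p x)"
  by (simp add: trunc_log_def poly_sum)

lemma fps_deriv_power_nat:
  fixes A :: "'a::comm_ring_1 fps"
  shows "fps_deriv (A ^ n) = of_nat n * A ^ (n - 1) * fps_deriv A"
proof (induction n)
  case (Suc n)
  then show ?case
    by (cases n) (simp_all add: algebra_simps)
qed simp

text \<open>
  The identity \<open>log(1 + A)' = A' / (1 + A)\<close> survives truncation: the error term is
  \<open>\<plusminus>A\<^sup>n\<^sup>-\<^sup>1 A'\<close>, and \<open>n A\<^sup>n\<^sup>-\<^sup>1 A' = (A\<^sup>n)' = 0\<close> with \<open>n\<close> invertible.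
\<close>

lemma fps_deriv_trunc_log:
  fixes A :: "'a::comm_ring_1 fps"
  assumes c: "\<And>i. i > 0 \<Longrightarrow> of_nat i * c i = ((-1) ^ (i - 1) :: 'a)" and A: "A ^ n = 0"
  shows "(1 + A) * fps_deriv (trunc_log (\<lambda>i. fps_const (c i)) n A) = fps_deriv A"
proof -
  have n: "n > 0"
    using A by (cases n) auto
  have sign: "fps_const (c i) * of_nat i = (-1) ^ (i - 1)" if "i > 0" for i
  proof -
    have "fps_const (c i) * of_nat i = fps_const (of_nat i * c i)"
      by (simp add: fps_of_nat[symmetric] mult.commute)
    also have "\<dots> = (fps_const (- 1)) ^ (i - 1)"
      by (simp only: c[OF that] fps_const_power)
    also have "fps_const (- 1 :: 'a) = - 1"
      by (simp flip: fps_const_neg)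
    finally show ?thesis .
  qed
  have summand: "fps_const (c i) * fps_deriv (A ^ i) = (- A) ^ (i - 1) * fps_deriv A" if "i > 0" for i
  proof -
    have "fps_const (c i) * fps_deriv (A ^ i)
        = fps_const (c i) * of_nat i * (A ^ (i - 1) * fps_deriv A)"
      by (simp only: fps_deriv_power_nat mult_ac)
    then show ?thesis
      using that by (simp add: sign power_minus[of A] mult.assoc)
  qed
  have "fps_deriv (trunc_log (\<lambda>i. fps_const (c i)) n A)
      = (\<Sum>i = 1..n - 1. (- A) ^ (i - 1) * fps_deriv A)"
    unfolding trunc_log_def fps_deriv_sum fps_deriv_mult_const_left
    by (intro sum.cong refl summand) auto
  also have "\<dots> = (\<Sum>j<n - 1. (- A) ^ j) * fps_deriv A"
    unfolding sum_distrib_right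
    by (rule sum.reindex_bij_witness[of _ Suc "\<lambda>i. i - 1"]) auto
  finally have "(1 + A) * fps_deriv (trunc_log (\<lambda>i. fps_const (c i)) n A)
      = ((1 - (- A)) * (\<Sum>j<n - 1. (- A) ^ j)) * fps_deriv A"
    by (simp add: mult.assoc)
  also have "\<dots> = (1 - (- A) ^ (n - 1)) * fps_deriv A"
    by (simp only: one_diff_power_eq)
  also have "\<dots> = fps_deriv A - fps_const (c n) * fps_deriv (A ^ n)"
    by (simp only: summand[OF n] left_diff_distrib mult_1_left)
  finally show ?thesis
    using A by simp
qed

text \<open>
  Functional equation of the logarithm. Replace \<open>v\<close>, \<open>w\<close> by \<open>tv\<close>, \<open>tw\<close> and let \<open>F(t)\<close> be the
  difference of the two sides. Logarithmic derivatives are additive, so \<open>F' = 0\<close>; since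
  positive integers are invertible and \<open>F(0) = 0\<close>, this gives \<open>F = 0\<close>, and \<open>t = 1\<close> is the claim.
  The difference \<open>F\<close> is a polynomial, so that it can be evaluated at \<open>1\<close>; its derivative is taken in
  the power series ring, since the coefficients may be zero divisors and \<^const>\<open>pderiv\<close> presumes none.
\<close>

lemma trunc_log_add:
  fixes v w :: "'a::comm_ring_1"
  assumes c: "\<And>i. i > 0 \<Longrightarrow> of_nat i * c i = ((-1) ^ (i - 1) :: 'a)"
    and v: "v ^ m = 0" and w: "w ^ m = 0" and vw: "(v + w + v * w) ^ m = 0"
  shows "trunc_log c m (v + w + v * w) = trunc_log c m v + trunc_log c m w"
proof -
  define a b where "a = [:0, v:]" and "b = [:0, w:]"
  define d where "d = a + b + a * b"
  \<comment> \<open>The nilpotency order of \<open>(1 + tv)(1 + tw) - 1\<close> may exceed \<open>m\<close>; \<open>3m\<close> is enough.\<close>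
  define n where "n = m + m + m"
  define L where "L = trunc_log (\<lambda>i. [:c i:]) n"
  define F where "F = L d - L a - L b"
  have lin: "[:0, x:] = [:x:] * [:0, 1:]" for x :: 'a
    by simp
  have am: "a ^ m = 0" and bm: "b ^ m = 0"
    unfolding a_def b_def lin[of v] lin[of w] power_mult_distrib
    by (simp_all only: poly_const_pow v w pCons_0_0 mult_zero_left)
  have an: "a ^ n = 0" and bn: "b ^ n = 0"
    by (simp_all add: n_def power_add am bm)
  have dn: "d ^ n = 0"
    unfolding d_def n_def by (intro nilpotent_add am bm) (simp add: power_mult_distrib am)
  have log_deriv: "(1 + fps_of_poly p) * fps_deriv (fps_of_poly (L p)) = fps_deriv (fps_of_poly p)"
    if "p ^ n = 0" for p
    unfolding L_def fps_of_poly_trunc_log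
    by (rule fps_deriv_trunc_log[OF c]) (use that in \<open>simp_all flip: fps_of_poly_power\<close>)
  define A B where "A = fps_of_poly a" and "B = fps_of_poly b"
  have D: "fps_of_poly d = A + B + A * B"
    by (simp only: d_def A_def B_def fps_of_poly_add fps_of_poly_mult)
  have "(1 + fps_of_poly d) * fps_deriv (fps_of_poly F)
      = (1 + fps_of_poly d) * fps_deriv (fps_of_poly (L d))
        - (1 + B) * ((1 + A) * fps_deriv (fps_of_poly (L a)))
        - (1 + A) * ((1 + B) * fps_deriv (fps_of_poly (L b)))"
    unfolding F_def D fps_of_poly_diff fps_deriv_sub by (simp add: algebra_simps)
  also have "\<dots> = fps_deriv (A + B + A * B) - (1 + B) * fps_deriv A - (1 + A) * fps_deriv B"
    using log_deriv[OF an] log_deriv[OF bn] log_deriv[OF dn] by (simp only: A_def B_def D)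
  also have "\<dots> = 0"
    by (simp add: algebra_simps)
  finally have "(1 - fps_of_poly (- d)) * fps_deriv (fps_of_poly F) = 0"
    by (simp add: fps_of_poly_uminus)
  moreover have "(- d) ^ n = 0"
    by (simp add: power_minus[of d] dn)
  then have "fps_of_poly (- d) ^ n = 0"
    by (simp flip: fps_of_poly_power)
  ultimately have deriv0: "fps_deriv (fps_of_poly F) = 0"
    using unipotent_mult_eq_0 by blast
  have "coeff F k = 0" for k
  proof (cases k)
    case 0
    have "poly F 0 = 0"
      by (simp add: F_def L_def poly_trunc_log a_def b_def d_def trunc_log_0)
    with 0 show ?thesis
      by (simp add: poly_0_coeff_0)
  next
    case (Suc j)
    have "of_nat k * coeff F k = 0"
      using arg_cong[OF deriv0, of "\<lambda>f. fps_nth f j"] Suc by (simp del: of_nat_Suc)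
    then have "of_nat k * c k * coeff F k = 0"
      by (simp add: mult.assoc mult.left_commute[of "of_nat k"])
    then have "(-1) ^ (k - 1) * coeff F k = 0"
      using c[of k] Suc by simp
    then show ?thesis
      by (cases "even (k - 1)") simp_all
  qed
  then have "F = 0"
    by (simp add: poly_eq_iff)
  then have "poly F 1 = 0"
    by simp
  then have "trunc_log c n (v + w + v * w) = trunc_log c n v + trunc_log c n w"
    by (simp add: F_def L_def poly_trunc_log a_def b_def d_def algebra_simps)
  then show ?thesis
    using trunc_log_mono[of _ m n c] v w vw by (simp add: n_def)
qed

text \<open>
  The logarithm of \<open>1 + v\<close> is \<open>v\<close> times a unipotent unit.
\<close>

lemma trunc_log_eq_0_imp:
  fixes v :: "'a::comm_ring_1"
  assumes c: "c 1 = 1" and v: "v ^ m = 0" and log: "trunc_log c m v = 0"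
  shows "v = 0"
proof (cases "m \<le> 1")
  case True
  then show ?thesis
    using v by (cases m) auto
next
  case False
  define q where "q = (\<Sum>i = 2..m - 1. c i * v ^ (i - 2))"
  have "{1..m - 1} = insert 1 {2..m - 1}"
    using False by auto
  then have "trunc_log c m v = v + (\<Sum>i = 2..m - 1. c i * v ^ i)"
    by (simp only: trunc_log_def) (simp add: c[simplified])
  also have "(\<Sum>i = 2..m - 1. c i * v ^ i) = v * v * q"
    unfolding q_def sum_distrib_left
  proof (rule sum.cong[OF refl])
    fix i assume "i \<in> {2..m - 1}"
    then have "2 + (i - 2) = i"
      by (intro le_add_diff_inverse) simp
    then have "v ^ i = v ^ (2 + (i - 2))"
      by simp
    then have "v ^ i = v * v * v ^ (i - 2)"
      by (simp only: power_add power2_eq_square)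
    then show "c i * v ^ i = v * v * (c i * v ^ (i - 2))"
      by (simp only: mult_ac)
  qed
  finally have "v * (1 - (- (v * q))) = 0"
    using log by (simp add: algebra_simps)
  moreover have "(- (v * q)) ^ m = 0"
    by (simp add: power_minus[of "v * q"] power_mult_distrib v)
  ultimately show ?thesis
    using unipotent_mult_eq_0 by (metis mult.commute)
qed

section \<open>Joint eigenfunctionals of separable elements\<close>

text \<open>
  A commutative ring acts on the functions on it by \<open>(s\<phi>)(x) = \<phi>(sx)\<close>; this is the function \<open>q(s)\<phi>\<close>
  for a polynomial \<open>q\<close> whose coefficients lie in the field of values.
\<close>

definition poly_action :: "'l::field poly \<Rightarrow> 'r::comm_ring_1 \<Rightarrow> ('r \<Rightarrow> 'l) \<Rightarrow> 'r \<Rightarrow> 'l"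
  where "poly_action q s \<phi> x = (\<Sum>i\<le>degree q. coeff q i * \<phi> (s ^ i * x))"

lemma poly_action_0 [simp]: "poly_action 0 s \<phi> x = 0"
  by (simp add: poly_action_def)

lemma poly_action_pCons:
  "poly_action (pCons a q) s \<phi> x = a * \<phi> x + poly_action q s \<phi> (s * x)"
  by (cases "q = 0") (simp_all add: poly_action_def sum.atMost_Suc_shift mult_ac del: sum.atMost_Suc)

lemma poly_action_add:
  "poly_action (p + q) s \<phi> x = poly_action p s \<phi> x + poly_action q s \<phi> x"
  by (induction p q arbitrary: x rule: poly_induct2) (simp_all add: poly_action_pCons algebra_simps)

lemma poly_action_smult: "poly_action (smult a q) s \<phi> x = a * poly_action q s \<phi> x"
  by (induction q arbitrary: x) (simp_all add: poly_action_pCons algebra_simps)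

lemma poly_action_linear_factor:
  "poly_action ([:- c, 1:] * q) s \<phi> x = poly_action q s (\<lambda>x. \<phi> (s * x) - c * \<phi> x) x"
proof -
  have "[:- c, 1:] * q = smult (- c) q + pCons 0 q"
    by simp
  then have "poly_action ([:- c, 1:] * q) s \<phi> x
      = - c * poly_action q s \<phi> x + poly_action q s \<phi> (s * x)"
    by (simp only: poly_action_add poly_action_smult poly_action_pCons) simp
  also have "\<dots> = poly_action q s (\<lambda>x. \<phi> (s * x) - c * \<phi> x) x"
    by (simp add: poly_action_def sum_distrib_left algebra_simps sum_subtractf sum_negf)
  finally show ?thesis .
qed

lemma rsquarefree_right_factor:
  assumes "rsquarefree (p * q)"
  shows "rsquarefree q"
  unfolding rsquarefree_def
proof (intro conjI allI)
  have "p * q \<noteq> 0"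
    using assms by (simp add: rsquarefree_def)
  then show "q \<noteq> 0"
    by auto
  fix a
  have "order a p + order a q = 0 \<or> order a p + order a q = 1"
    using assms order_mult[OF \<open>p * q \<noteq> 0\<close>] by (metis rsquarefree_def)
  then show "order a q = 0 \<or> order a q = 1"
    by auto
qed

text \<open>
  This replaces the decomposition of \<open>\<phi>\<close> into eigenvectors of \<open>s\<close>. If \<open>c \<noteq> d\<close> are two roots of \<open>q\<close>,
  then \<open>(s - c)\<phi>\<close> and \<open>(s - d)\<phi>\<close> are annihilated by proper factors of \<open>q\<close>, hence vanish at \<open>y\<close> by
  induction, and their difference is \<open>(d - c)\<phi>\<close>. The predicate \<open>E\<close> carries the properties that the
  reduction must preserve, such as being an eigenvector of other elements.
\<close>

lemma vanish_if_eigen_vanish: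
  fixes q :: "'l::alg_closed_field poly" and \<phi> :: "'r::comm_ring_1 \<Rightarrow> 'l"
  assumes "rsquarefree q" and "\<And>x. poly_action q s \<phi> x = 0" and "E \<phi>"
    and E: "\<And>\<psi> c. E \<psi> \<Longrightarrow> E (\<lambda>x. \<psi> (s * x) - c * \<psi> x)"
    and eigen: "\<And>\<psi> c. E \<psi> \<Longrightarrow> (\<And>x. \<psi> (s * x) = c * \<psi> x) \<Longrightarrow> \<psi> y = 0"
  shows "\<phi> y = 0"
  using assms(1-3)
proof (induction "degree q" arbitrary: q \<phi> rule: less_induct)
  case less
  have q0: "q \<noteq> 0"
    using less.prems(1) by (simp add: rsquarefree_def)
  show ?case
  proof (cases "degree q = 0")
    case True
    then obtain a where "q = [:a:]"
      by (rule degree_eq_zeroE)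
    then show ?thesis
      using less.prems(2)[of y] q0 by (simp add: poly_action_pCons)
  next
    case False
    then obtain c where "poly q c = 0"
      using alg_closed_imp_poly_has_root[of q] by auto
    then obtain q1 where q1: "q = [:- c, 1:] * q1"
      by (auto simp: poly_eq_0_iff_dvd elim: dvdE)
    have q10: "q1 \<noteq> 0"
      using q0 q1 by auto
    show ?thesis
    proof (cases "degree q1 = 0")
      case True
      then obtain a where a: "q1 = [:a:]"
        by (rule degree_eq_zeroE)
      have "\<phi> (s * x) = c * \<phi> x" for x
        using less.prems(2)[of x] q10 unfolding q1 poly_action_linear_factor a
        by (simp add: poly_action_pCons)
      then show ?thesis
        by (rule eigen[OF less.prems(3)])
    next
      case False
      then obtain d where "poly q1 d = 0"
        using alg_closed_imp_poly_has_root[of q1] by auto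
      then obtain q2 where q2: "q1 = [:- d, 1:] * q2"
        by (auto simp: poly_eq_0_iff_dvd elim: dvdE)
      define q1' where "q1' = [:- c, 1:] * q2"
      have q1': "q = [:- d, 1:] * q1'"
        unfolding q1 q2 q1'_def by (simp only: mult_ac)
      have "c \<noteq> d"
      proof
        assume "c = d"
        then have "[:- c, 1:] ^ 2 dvd q"
          unfolding q1 q2 by (simp only: power2_eq_square mult.assoc dvd_triv_left flip: mult.assoc)
        then have "order c q \<ge> 2"
          using q0 by (simp add: order_divides)
        with less.prems(1) show False
          by (metis rsquarefree_def not_numeral_le_zero numeral_le_one_iff semiring_norm(69))
      qed
      have smaller: "\<phi> (s * y) - a * \<phi> y = 0" if p: "q = [:- a, 1:] * p" for a p
      proof (rule less.hyps[of p])
        have "p \<noteq> 0"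
          using p q0 by auto
        then show "degree p < degree q"
          by (simp only: p) (subst degree_mult_eq, auto)
        show "rsquarefree p"
          using less.prems(1) rsquarefree_right_factor p by metis
        show "poly_action p s (\<lambda>x. \<phi> (s * x) - a * \<phi> x) x = 0" for x
          using less.prems(2)[of x] unfolding p poly_action_linear_factor .
        show "E (\<lambda>x. \<phi> (s * x) - a * \<phi> x)"
          by (rule E[OF less.prems(3)])
      qed
      have "(d - c) * \<phi> y = 0"
        using smaller[OF q1] smaller[OF q1'] by (auto simp: algebra_simps)
      then show ?thesis
        using \<open>c \<noteq> d\<close> by (metis eq_iff_diff_eq_0 mult_eq_0_iff)
    qed
  qed
qed

context K_algebra
begin

text \<open>
  Linear functionals with values in the algebraic closure form a vector space over the closure
  on which \<open>R\<close> acts faithfully. They stand in for the base change of \<open>R\<close> to the closure.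
\<close>

definition functional :: "('r \<Rightarrow> 'k alg_closure) \<Rightarrow> bool"
  where "functional \<phi> \<longleftrightarrow>
    (\<forall>x y. \<phi> (x + y) = \<phi> x + \<phi> y) \<and> (\<forall>c x. \<phi> (scale c x) = to_ac c * \<phi> x)"

lemma functional_zero: "functional \<phi> \<Longrightarrow> \<phi> 0 = 0"
  unfolding functional_def by (metis add_cancel_right_left)

lemma functional_diff: "functional \<phi> \<Longrightarrow> \<phi> (x - y) = \<phi> x - \<phi> y"
  unfolding functional_def by (metis add_diff_cancel diff_add_cancel)

lemma functionals_separate:
  assumes "\<And>\<phi>. functional \<phi> \<Longrightarrow> \<phi> r = 0"
  shows "r = 0"
proof (rule ccontr)
  assume "r \<noteq> 0"
  then have ind: "independent {r}"
    by simp
  define B where "B = extend_basis {r}"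
  have B: "independent B" "span B = UNIV" "r \<in> B"
    using independent_extend_basis[OF ind] span_extend_basis[OF ind]
      extend_basis_superset[OF ind] by (auto simp: B_def)
  have "functional (\<lambda>x. to_ac (representation B x r))"
    unfolding functional_def using B by (simp add: representation_add representation_scale)
  then have "to_ac (representation B r r) = 0"
    by (rule assms)
  then show False
    using B by (simp add: representation_basis)
qed

lemma scale_eq_mult: "scale c x = scale c 1 * x"
  using scale_mult_left[of c 1 x] by simp

lemma poly_action_alg_eval:
  assumes "functional \<phi>"
  shows "poly_action (map_poly to_ac p) s \<phi> x = \<phi> (alg_eval scale p s * x)"
proof (induction p arbitrary: x)
  case 0
  then show ?case
    using assms by (simp add: alg_eval_def functional_zero)
next
  case (pCons a p)
  have "alg_eval scale (pCons a p) s * x = scale a x + alg_eval scale p s * (s * x)"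
    by (simp add: alg_eval_def map_poly_pCons algebra_simps scale_eq_mult[of a x])
  then show ?case
    using assms pCons by (simp add: map_poly_pCons poly_action_pCons functional_def)
qed

definition eigen :: "'r \<Rightarrow> ('r \<Rightarrow> 'k alg_closure) \<Rightarrow> bool"
  where "eigen r \<phi> \<longleftrightarrow> (\<exists>c. \<forall>x. \<phi> (r * x) = c * \<phi> x)"

text \<open>
  Since the \<open>s\<^sub>i\<close> commute, they can be diagonalized one after the other: \<open>J\<close> collects the indices
  already treated.
\<close>

lemma zero_if_joint_eigen_vanish:
  assumes "finite I" and sep: "\<And>i. i \<in> I \<Longrightarrow> s i \<in> separable_elements scale"
    and vanish: "\<And>\<psi>. functional \<psi> \<Longrightarrow> (\<And>i. i \<in> I \<Longrightarrow> eigen (s i) \<psi>) \<Longrightarrow> \<psi> y = 0"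
  shows "y = 0"
proof -
  have "\<phi> y = 0" if "functional \<phi>" and "\<forall>j\<in>J. eigen (s j) \<phi>"
      and "\<And>\<psi>. functional \<psi> \<Longrightarrow> (\<forall>i\<in>I \<union> J. eigen (s i) \<psi>) \<Longrightarrow> \<psi> y = 0" for J \<phi>
    using assms(1) sep that
  proof (induction I arbitrary: J \<phi> rule: finite_induct)
    case (insert i I)
    obtain p where "alg_eval scale p (s i) = 0" and sqfree: "rsquarefree (map_poly to_ac p)"
      using insert.prems(1)[of i] by (auto simp: separable_elements_def is_minimal_poly_def)
    then have root: "poly_action (map_poly to_ac p) (s i) \<phi> x = 0" for x
      using insert.prems(2) by (simp add: poly_action_alg_eval functional_zero)
    show ?case
    proof (rule vanish_if_eigen_vanish[OF sqfree root,
          where E = "\<lambda>\<psi>. functional \<psi> \<and> (\<forall>j\<in>J. eigen (s j) \<psi>)"])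
      show "functional \<phi> \<and> (\<forall>j\<in>J. eigen (s j) \<phi>)"
        using insert.prems by simp
      fix \<psi> c
      assume \<psi>: "functional \<psi> \<and> (\<forall>j\<in>J. eigen (s j) \<psi>)"
      have "eigen r (\<lambda>x. \<psi> (s i * x) - c * \<psi> x)" if r: "eigen r \<psi>" for r
      proof -
        obtain e where "\<And>x. \<psi> (r * x) = e * \<psi> x"
          using r by (auto simp: eigen_def)
        then have "\<psi> (s i * (r * x)) - c * \<psi> (r * x) = e * (\<psi> (s i * x) - c * \<psi> x)" for x
          by (simp only: mult.left_commute[of "s i" r] right_diff_distrib mult.left_commute[of c e])
        then show ?thesis
          by (auto simp: eigen_def)
      qed
      moreover have "functional (\<lambda>x. \<psi> (s i * x) - c * \<psi> x)"
      proof -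
        have "s i * scale a x = scale a (s i * x)" for a x
          by (metis mult.commute scale_mult_left)
        then show ?thesis
          using \<psi> by (simp add: functional_def algebra_simps)
      qed
      ultimately show "functional (\<lambda>x. \<psi> (s i * x) - c * \<psi> x) \<and>
          (\<forall>j\<in>J. eigen (s j) (\<lambda>x. \<psi> (s i * x) - c * \<psi> x))"
        using \<psi> by blast
    next
      fix \<psi> c
      assume "functional \<psi> \<and> (\<forall>j\<in>J. eigen (s j) \<psi>)" and "\<And>x. \<psi> (s i * x) = c * \<psi> x"
      then have "functional \<psi>" and "\<forall>j\<in>insert i J. eigen (s j) \<psi>"
        by (auto simp: eigen_def)
      then show "\<psi> y = 0"
        by (rule insert.IH[rotated]) (use insert.prems in auto)
    qed
  qed auto
  from this[of _ "{}"] show ?thesis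
    using functionals_separate vanish by simp
qed

text \<open>
  On a joint eigenfunctional the nilpotent element \<open>v\<close> acts by a scalar \<open>e\<close> with
  \<open>e\<^sup>n \<psi>(1) = \<psi>(v\<^sup>n) = 0\<close>, so \<open>\<psi>(v) = e \<psi>(1) = 0\<close>.
\<close>

lemma zero_if_nilpotent_eigen:
  assumes fin: "finite I" and sep: "\<And>i. i \<in> I \<Longrightarrow> s i \<in> separable_elements scale"
    and eig: "\<And>\<psi>. (\<And>i. i \<in> I \<Longrightarrow> eigen (s i) \<psi>) \<Longrightarrow> eigen (1 + v) \<psi>"
    and v: "v ^ n = 0"
  shows "v = 0"
  using fin sep
proof (rule zero_if_joint_eigen_vanish)
  fix \<psi>
  assume \<psi>: "functional \<psi>" and "\<And>i. i \<in> I \<Longrightarrow> eigen (s i) \<psi>"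
  then have "eigen (1 + v) \<psi>"
    by (intro eig)
  then obtain c where c: "\<And>x. \<psi> ((1 + v) * x) = c * \<psi> x"
    by (auto simp: eigen_def)
  have "v * x = (1 + v) * x - x" for x
    by (simp add: algebra_simps)
  then have v_eig: "\<psi> (v * x) = (c - 1) * \<psi> x" for x
    by (simp only: functional_diff[OF \<psi>] c) (simp add: algebra_simps)
  have "\<psi> (v ^ j) = (c - 1) ^ j * \<psi> 1" for j
    by (induction j) (simp_all add: v_eig)
  from this[of n] have "c = 1 \<or> \<psi> 1 = 0"
    using v functional_zero[OF \<psi>] by auto
  then show "\<psi> v = 0"
    using v_eig[of 1] by auto
qed

end

section \<open>Products of powers in commutative groups\<close>

lemma (in comm_group) power_product_in_subgroup:
  assumes H: "subgroup H G" and x: "\<And>i. i \<in> A \<Longrightarrow> x i \<in> H"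
  shows "(\<Otimes>i\<in>A. x i [^] (a i :: int)) \<in> H"
  using x
proof (induction A rule: infinite_finite_induct)
  case (insert i A)
  have "\<And>j. j \<in> insert i A \<Longrightarrow> x j \<in> carrier G"
    using subgroup.mem_carrier[OF H] insert.prems by blast
  moreover have "x i [^] a i \<in> H"
    using group.int_pow_closed[OF subgroup.subgroup_is_group[OF H is_group], of "x i"]
      int_pow_consistent[OF H] insert.prems by simp
  ultimately show ?case
    using insert by (simp add: finprod_insert Pi_def subgroup.m_closed[OF H])
qed (simp_all add: subgroup.one_closed[OF H])

lemma hom_power_product:
  assumes G: "comm_group G" and H: "comm_group H" and h: "h \<in> hom G H"
    and x: "\<And>i. i \<in> A \<Longrightarrow> x i \<in> carrier G"
  shows "h (\<Otimes>\<^bsub>G\<^esub>i\<in>A. x i [^]\<^bsub>G\<^esub> (a i :: int)) = (\<Otimes>\<^bsub>H\<^esub>i\<in>A. h (x i) [^]\<^bsub>H\<^esub> a i)"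
proof -
  interpret G: comm_group G by fact
  interpret H: comm_group H by fact
  interpret group_hom G H h
    using h by unfold_locales
  show ?thesis
    using x
  proof (induction A rule: infinite_finite_induct)
    case (insert i A)
    then show ?case
      by (simp add: G.finprod_insert H.finprod_insert Pi_def hom_int_pow)
  qed simp_all
qed

lemma (in comm_group) additive_on_power_product:
  fixes l :: "'a \<Rightarrow> 'c::comm_ring_1"
  assumes H: "subgroup H G" and add: "\<And>u v. u \<in> H \<Longrightarrow> v \<in> H \<Longrightarrow> l (u \<otimes> v) = l u + l v"
    and x: "\<And>i. i \<in> A \<Longrightarrow> x i \<in> H"
  shows "l (\<Otimes>i\<in>A. x i [^] (a i :: int)) = (\<Sum>i\<in>A. of_int (a i) * l (x i))"
proof -
  have one: "l \<one> = 0"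
    using add[of \<one> \<one>] subgroup.one_closed[OF H] by simp
  have pow: "x [^] n \<in> H \<and> l (x [^] n) = of_nat n * l x" if "x \<in> H" for x and n :: nat
    by (induction n)
      (auto simp: that one add algebra_simps subgroup.one_closed[OF H] subgroup.m_closed[OF H])
  have inv: "l (inv x) = - l x" if "x \<in> H" for x
    using add[OF that subgroup.m_inv_closed[OF H that]] one subgroup.mem_carrier[OF H that]
    by (simp add: eq_neg_iff_add_eq_0 add.commute)
  have int_pow: "l (x [^] z) = of_int z * l x" if "x \<in> H" for x and z :: int
  proof (cases z)
    case (nonneg n)
    then show ?thesis
      using pow[OF that] by (simp add: int_pow_int)
  next
    case (neg n)
    then show ?thesis
      using pow[OF that, of "Suc n"] inv subgroup.mem_carrier[OF H that]
      by (simp only: int_pow_neg_int) (simp add: algebra_simps)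
  qed
  show ?thesis
    using x
  proof (induction A rule: infinite_finite_induct)
    case (insert i A)
    have "\<And>j. j \<in> insert i A \<Longrightarrow> x j \<in> carrier G"
      using subgroup.mem_carrier[OF H] insert.prems by blast
    moreover have "x i [^] a i \<in> H"
      using power_product_in_subgroup[OF H, of "{i}" x a] insert.prems calculation by simp
    moreover have "(\<Otimes>i\<in>A. x i [^] a i) \<in> H"
      by (rule power_product_in_subgroup[OF H]) (simp add: insert.prems)
    ultimately show ?case
      using insert by (simp add: finprod_insert Pi_def add int_pow)
  qed (simp_all add: one)
qed

lemma (in comm_group) power_product_mult:
  assumes x: "\<And>i. i \<in> A \<Longrightarrow> x i \<in> carrier G" and y: "\<And>i. i \<in> A \<Longrightarrow> y i \<in> carrier G"
    and z: "\<And>i. i \<in> A \<Longrightarrow> z i = x i \<otimes> y i"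
  shows "(\<Otimes>i\<in>A. z i [^] (a i :: int)) = (\<Otimes>i\<in>A. x i [^] a i) \<otimes> (\<Otimes>i\<in>A. y i [^] a i)"
proof -
  have "(\<Otimes>i\<in>A. z i [^] a i) = (\<Otimes>i\<in>A. x i [^] a i \<otimes> y i [^] a i)"
    using x y z by (intro finprod_cong') (auto simp: int_pow_distrib)
  then show ?thesis
    using x y by (simp add: finprod_multf Pi_def)
qed

section \<open>Units and residue classes\<close>

abbreviation unit_group :: "'r::comm_ring_1 monoid"
  where "unit_group \<equiv> units_of alg_ring"

lemma alg_ring_simps [simp]:
  "carrier alg_ring = UNIV" "x \<otimes>\<^bsub>alg_ring\<^esub> y = x * y" "\<one>\<^bsub>alg_ring\<^esub> = 1"
  "x \<oplus>\<^bsub>alg_ring\<^esub> y = x + y" "\<zero>\<^bsub>alg_ring\<^esub> = 0"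
  by (simp_all add: ring_of_type_algebra_def)

interpretation alg: cring "alg_ring :: 'r::comm_ring_1 ring"
  by (rule cring_from_type_algebra)

interpretation ug: comm_group "unit_group :: 'r::comm_ring_1 monoid"
  by (rule alg.units_comm_group)

lemma alg_ring_minus [simp]: "\<ominus>\<^bsub>alg_ring\<^esub> x = - x" "x \<ominus>\<^bsub>alg_ring\<^esub> y = x - y"
proof -
  show minus: "\<ominus>\<^bsub>alg_ring\<^esub> x = - x" for x :: 'a
    by (rule alg.minus_equality) simp_all
  show "x \<ominus>\<^bsub>alg_ring\<^esub> y = x - y"
    by (simp add: a_minus_def minus)
qed

lemma in_Units_alg_ring_iff: "x \<in> Units alg_ring \<longleftrightarrow> (\<exists>y. x * y = 1)"
  by (auto simp: Units_def mult.commute)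

lemma unit_group_simps [simp]:
  "carrier unit_group = Units alg_ring" "x \<otimes>\<^bsub>unit_group\<^esub> y = x * y" "\<one>\<^bsub>unit_group\<^esub> = 1"
  by (simp_all add: units_of_def)

lemma inv_alg_ring_mult [simp]:
  assumes "x \<in> Units alg_ring"
  shows "x * inv\<^bsub>alg_ring\<^esub> x = 1" "inv\<^bsub>alg_ring\<^esub> x * x = 1"
  using alg.Units_r_inv[OF assms] alg.Units_l_inv[OF assms] by simp_all

lemma inv_alg_ring_eqI:
  assumes "x * y = 1"
  shows "inv\<^bsub>alg_ring\<^esub> x = y"
  using alg.comm_inv_char[of x y] assms by simp

lemma unit_group_inv: "x \<in> Units alg_ring \<Longrightarrow> inv\<^bsub>unit_group\<^esub> x = inv\<^bsub>alg_ring\<^esub> x"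
  by (rule alg.units_of_inv)

text \<open>
  Geometric series: \<open>x / (x - n) = 1 / (1 - x\<^sup>-\<^sup>1n)\<close>.
\<close>

lemma unit_minus_nilpotent:
  fixes x n :: "'r::comm_ring_1"
  assumes x: "x \<in> Units alg_ring" and n: "n ^ k = 0"
  shows "x - n \<in> Units alg_ring"
    and "x * inv\<^bsub>alg_ring\<^esub> (x - n) = (\<Sum>j<k. (inv\<^bsub>alg_ring\<^esub> x) ^ j * n ^ j)"
proof -
  define y where "y = inv\<^bsub>alg_ring\<^esub> x"
  define G where "G = (\<Sum>j<k. (y * n) ^ j)"
  have xy: "x * y = 1"
    using x by (simp add: y_def)
  then have "x - n = x * (1 - y * n)"
    by (simp add: algebra_simps flip: mult.assoc)
  then have "(x - n) * (y * G) = (x * y) * ((1 - y * n) * G)"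
    by (simp only: mult_ac)
  also have "\<dots> = 1"
    unfolding G_def using xy unipotent_inverse[of "y * n" k] n by (simp add: power_mult_distrib)
  finally have inverse: "(x - n) * (y * G) = 1" .
  then show "x - n \<in> Units alg_ring"
    by (auto simp: in_Units_alg_ring_iff)
  have "x * (y * G) = G"
    using xy by (simp flip: mult.assoc)
  then show "x * inv\<^bsub>alg_ring\<^esub> (x - n) = (\<Sum>j<k. (inv\<^bsub>alg_ring\<^esub> x) ^ j * n ^ j)"
    by (simp add: inv_alg_ring_eqI[OF inverse] G_def y_def power_mult_distrib)
qed

text \<open>
  Reduction modulo \<open>I\<close> maps unit groups to unit groups, so relations between the residue classes
  are the products of powers that are congruent to \<open>1\<close>.
\<close>

lemma exponent_lattice_Quot:
  fixes I :: "'r::comm_ring_1 set"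
  assumes I: "ideal I alg_ring" and f: "\<And>i. i \<in> {1..k} \<Longrightarrow> f i \<in> Units alg_ring"
  shows "exponent_lattice (units_of (alg_ring Quot I)) k (\<lambda>j. I +>\<^bsub>alg_ring\<^esub> f j)
    = {a \<in> int_vecs k. (\<Otimes>\<^bsub>unit_group\<^esub>i\<in>{1..k}. f i [^]\<^bsub>unit_group\<^esub> a i) - 1 \<in> I}"
proof -
  interpret I: ideal I alg_ring by fact
  let ?Q = "alg_ring Quot I"
  let ?h = "\<lambda>r. I +>\<^bsub>alg_ring\<^esub> r"
  interpret Q: cring ?Q
    by (rule I.quotient_is_cring) (rule alg.is_cring)
  have hom: "?h \<in> ring_hom alg_ring ?Q"
    by (rule I.rcos_ring_hom)
  have unit: "?h u \<in> Units ?Q" if u: "u \<in> Units alg_ring" for u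
  proof -
    have "?h u \<otimes>\<^bsub>?Q\<^esub> ?h (inv\<^bsub>alg_ring\<^esub> u) = \<one>\<^bsub>?Q\<^esub>"
      using u ring_hom_mult[OF hom, of u "inv\<^bsub>alg_ring\<^esub> u"] ring_hom_one[OF hom] by simp
    moreover have "?h x \<in> carrier ?Q" for x
      using ring_hom_closed[OF hom] by simp
    ultimately show ?thesis
      by (metis Q.unit_factor Q.Units_one_closed)
  qed
  then have "?h \<in> hom unit_group (units_of ?Q)"
    using ring_hom_mult[OF hom] by (auto simp: hom_def units_of_def)
  note hom_power_product[OF ug.comm_group_axioms Q.units_comm_group this, of "{1..k}" f]
  then have product: "(\<Otimes>\<^bsub>units_of ?Q\<^esub>i\<in>{1..k}. ?h (f i) [^]\<^bsub>units_of ?Q\<^esub> a i)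
      = ?h (\<Otimes>\<^bsub>unit_group\<^esub>i\<in>{1..k}. f i [^]\<^bsub>unit_group\<^esub> a i)" for a :: "nat \<Rightarrow> int"
    using f by simp
  have "?h x = \<one>\<^bsub>units_of ?Q\<^esub> \<longleftrightarrow> x - 1 \<in> I" for x
    using alg.quotient_eq_iff_same_a_r_cos[OF I, of x 1] ring_hom_one[OF hom]
    by (simp add: units_of_one)
  then show ?thesis
    unfolding exponent_lattice_def product by simp
qed

lemma power_in_ideal_power:
  assumes "x \<in> I"
  shows "x ^ n \<in> I [^]\<^bsub>ideals_set (alg_ring :: 'r::comm_ring_1 ring)\<^esub> n"
proof (induction n)
  case 0
  then show ?case
    by (simp add: nat_pow_def ideals_set_def)
next
  case (Suc n)
  then have "x ^ n \<otimes>\<^bsub>alg_ring\<^esub> x \<in> (I [^]\<^bsub>ideals_set alg_ring\<^esub> n) \<cdot>\<^bsub>alg_ring\<^esub> I"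
    using assms by (intro ideal_prod.prod)
  then show ?case
    by (simp add: ideals_set_def mult.commute)
qed

lemma zero_radical_closed:
  fixes x y r :: "'r::comm_ring_1"
  assumes x: "x \<in> zero_radical alg_ring"
  shows "y \<in> zero_radical alg_ring \<Longrightarrow> x + y \<in> zero_radical alg_ring"
    and "x * r \<in> zero_radical alg_ring"
proof -
  have "x + y \<in> I" if "maximalideal I alg_ring" "x \<in> I" "y \<in> I" for I
  proof -
    interpret maximalideal I alg_ring by fact
    show ?thesis
      using a_closed[of x y] that by simp
  qed
  then show "y \<in> zero_radical alg_ring \<Longrightarrow> x + y \<in> zero_radical alg_ring"
    using x by (auto simp: zero_radical_def)
  have "x * r \<in> I" if "maximalideal I alg_ring" "x \<in> I" for I
  proof -
    interpret maximalideal I alg_ring by fact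
    show ?thesis
      using I_r_closed[of x r] that by simp
  qed
  then show "x * r \<in> zero_radical alg_ring"
    using x by (auto simp: zero_radical_def)
qed

lemma unipotents_subgroup:
  "subgroup {u \<in> Units alg_ring. u - 1 \<in> zero_radical (alg_ring :: 'r::comm_ring_1 ring)} unit_group"
proof (rule ug.subgroupI)
  have "0 \<in> I" if "maximalideal I (alg_ring :: 'r ring)" for I
  proof -
    interpret maximalideal I alg_ring by fact
    show ?thesis
      using zero_closed by simp
  qed
  then have "(1 :: 'r) \<in> {u \<in> Units alg_ring. u - 1 \<in> zero_radical alg_ring}"
    by (auto simp: zero_radical_def in_Units_alg_ring_iff)
  then show "{u \<in> Units alg_ring. u - 1 \<in> zero_radical (alg_ring :: 'r ring)} \<noteq> {}"
    by blast
next
  fix u v :: 'r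
  assume u: "u \<in> {u \<in> Units alg_ring. u - 1 \<in> zero_radical alg_ring}"
  then have "- ((u - 1) * inv\<^bsub>alg_ring\<^esub> u) = inv\<^bsub>alg_ring\<^esub> u - 1"
    by (simp add: left_diff_distrib)
  then have "inv\<^bsub>alg_ring\<^esub> u - 1 = (u - 1) * (- (inv\<^bsub>alg_ring\<^esub> u))"
    by simp
  then show "inv\<^bsub>unit_group\<^esub> u \<in> {u \<in> Units alg_ring. u - 1 \<in> zero_radical alg_ring}"
    using u zero_radical_closed(2)[of "u - 1" "- (inv\<^bsub>alg_ring\<^esub> u)"] by (simp add: unit_group_inv)
  assume v: "v \<in> {u \<in> Units alg_ring. u - 1 \<in> zero_radical alg_ring}"
  have "u * v - 1 = (u - 1) * v + (v - 1)"
    by (simp add: algebra_simps)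
  also have "\<dots> \<in> zero_radical alg_ring"
    using u v by (intro zero_radical_closed) simp_all
  finally show "u \<otimes>\<^bsub>unit_group\<^esub> v \<in> {u \<in> Units alg_ring. u - 1 \<in> zero_radical alg_ring}"
    using u v alg.Units_m_closed[of u v] by simp
qed auto

section \<open>Products of powers of separable units\<close>

context K_algebra
begin

lemma eigen_subgroup: "subgroup {u \<in> Units alg_ring. eigen u \<psi>} unit_group"
proof (rule ug.subgroupI)
  have "1 \<in> {u \<in> Units alg_ring. eigen u \<psi>}"
    by (auto simp: in_Units_alg_ring_iff eigen_def intro: exI[of _ 1])
  then show "{u \<in> Units alg_ring. eigen u \<psi>} \<noteq> {}"
    by blast
next
  fix u v
  assume u: "u \<in> {u \<in> Units alg_ring. eigen u \<psi>}"
  then obtain c where c: "\<And>x. \<psi> (u * x) = c * \<psi> x"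
    by (auto simp: eigen_def)
  have cancel: "\<psi> x = c * \<psi> (inv\<^bsub>alg_ring\<^esub> u * x)" for x
    using c[of "inv\<^bsub>alg_ring\<^esub> u * x"] u by (simp flip: mult.assoc)
  \<comment> \<open>If \<open>c = 0\<close>, then \<open>\<psi> = 0\<close>, and any eigenvalue will do.\<close>
  have "\<psi> (inv\<^bsub>alg_ring\<^esub> u * x) = inverse c * \<psi> x" for x
    using cancel[of x] cancel[of "inv\<^bsub>alg_ring\<^esub> u * x"] by (cases "c = 0") simp_all
  then show "inv\<^bsub>unit_group\<^esub> u \<in> {u \<in> Units alg_ring. eigen u \<psi>}"
    using u by (auto simp: unit_group_inv eigen_def)
  assume v: "v \<in> {u \<in> Units alg_ring. eigen u \<psi>}"
  then obtain d where d: "\<And>x. \<psi> (v * x) = d * \<psi> x"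
    by (auto simp: eigen_def)
  have "\<psi> (u * v * x) = (c * d) * \<psi> x" for x
    by (simp only: mult.assoc c d)
  then have "eigen (u * v) \<psi>"
    by (auto simp: eigen_def)
  then show "u \<otimes>\<^bsub>unit_group\<^esub> v \<in> {u \<in> Units alg_ring. eigen u \<psi>}"
    using u v alg.Units_m_closed[of u v] by simp
qed auto

text \<open>
  The point where separability enters: products of powers of separable units behave like
  semisimple elements, and a semisimple unipotent element is trivial.
\<close>

lemma separable_power_product_eq_1:
  assumes "finite I" and "\<And>i. i \<in> I \<Longrightarrow> s i \<in> separable_elements scale"
    and unit: "\<And>i. i \<in> I \<Longrightarrow> s i \<in> Units alg_ring"
    and nilp: "((\<Otimes>\<^bsub>unit_group\<^esub>i\<in>I. s i [^]\<^bsub>unit_group\<^esub> (a i :: int)) - 1) ^ n = 0"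
  shows "(\<Otimes>\<^bsub>unit_group\<^esub>i\<in>I. s i [^]\<^bsub>unit_group\<^esub> a i) = 1"
proof -
  let ?S = "\<Otimes>\<^bsub>unit_group\<^esub>i\<in>I. s i [^]\<^bsub>unit_group\<^esub> a i"
  have "?S - 1 = 0"
    using assms(1,2) _ nilp
  proof (rule zero_if_nilpotent_eigen)
    fix \<psi>
    assume "\<And>i. i \<in> I \<Longrightarrow> eigen (s i) \<psi>"
    then have "?S \<in> {u \<in> Units alg_ring. eigen u \<psi>}"
      using unit by (intro ug.power_product_in_subgroup eigen_subgroup) auto
    then show "eigen (1 + (?S - 1)) \<psi>"
      by simp
  qed
  then show ?thesis
    by simp
qed

end

section \<open>The logarithm over a field of scalars\<close>

lemma (in K_algebra) unipotent_log_eq_trunc_log: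
  "unipotent_log scale m u = trunc_log (\<lambda>i. scale ((-1) ^ (i - 1) / of_nat i) 1) m (u - 1)"
  unfolding unipotent_log_def trunc_log_def by (intro sum.cong refl scale_eq_mult)

lemma (in K_algebra) of_nat_mult_log_coeff:
  fixes i :: nat
  assumes "(of_nat i :: 'k) \<noteq> 0"
  shows "of_nat i * scale ((-1) ^ (i - 1) / of_nat i) 1 = (-1) ^ (i - 1)"
proof -
  have "of_nat i * x = scale (of_nat i) x" for x
    by (induction i) (simp_all add: algebra_simps)
  moreover have "scale ((-1) ^ j) 1 = (-1) ^ j" for j
    by (cases "even j") simp_all
  ultimately show ?thesis
    using assms by simp
qed

section \<open>The exponent lattice\<close>

theorem mainTheorem8:
  fixes scale :: "'k::field_char_0 \<Rightarrow> 'r::comm_ring_1 \<Rightarrow> 'r"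
    and k s m :: nat
    and f f_sep f_nil l :: "nat \<Rightarrow> 'r"
    and mx :: "nat \<Rightarrow> 'r set"
    and \<Lambda> :: "nat \<Rightarrow> (nat \<Rightarrow> int) set"
    and M :: "(nat \<Rightarrow> int) set"
  assumes affine: "affine_K_algebra scale"
    and zero_dimensional: "krull_dim (alg_ring :: 'r ring) = 0"
    and units: "\<And>i. i \<in> {1..k} \<Longrightarrow> f i \<in> Units alg_ring"
    and m: "zero_radical alg_ring [^]\<^bsub>ideals_set (alg_ring :: 'r ring)\<^esub> m = {0}"
    and step1: "bij_betw mx {1..s} {I. maximalideal I alg_ring}"
    and step2: "\<And>i. i \<in> {1..s} \<Longrightarrow>
      \<Lambda> i = exponent_lattice (units_of (alg_ring Quot mx i)) k (\<lambda>j. mx i +>\<^bsub>alg_ring\<^esub> f j)"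
    and step3: "\<And>i. i \<in> {1..k} \<Longrightarrow>
      f i = f_sep i + f_nil i \<and> f_sep i \<in> separable_elements scale \<and> f_nil i \<in> zero_radical alg_ring"
    and step4: "\<And>i. i \<in> {1..k} \<Longrightarrow>
      l i = unipotent_log scale m (f i * inv\<^bsub>alg_ring\<^esub> (f_sep i))"
    and step5: "M = {y \<in> int_vecs k. (\<Sum>i = 1..k. of_int (y i) * l i) = 0}"
  shows "(\<forall>i\<in>{1..k}.
      unipotent_log scale m (f i * inv\<^bsub>alg_ring\<^esub> (f_sep i)) =
      unipotent_log scale m
        (\<Sum>j = 0..nilpotency_index (f_nil i) - 1. (inv\<^bsub>alg_ring\<^esub> (f i)) ^ j * f_nil i ^ j)) \<and>
    M \<inter> (\<Inter>i\<in>{1..s}. \<Lambda> i) = exponent_lattice (units_of alg_ring) k f"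
proof -
  interpret affine_K_algebra scale by (rule affine)
  let ?rad = "zero_radical (alg_ring :: 'r ring)"
  let ?inv = "m_inv (alg_ring :: 'r ring)"
  let ?G = "unit_group :: 'r monoid"
  let ?W = "{u \<in> Units alg_ring. u - 1 \<in> ?rad}"
  define u where "u i = f i * ?inv (f_sep i)" for i
  define F where "F a = (\<Otimes>\<^bsub>?G\<^esub>i\<in>{1..k}. f i [^]\<^bsub>?G\<^esub> a i)" for a :: "nat \<Rightarrow> int"
  define S where "S a = (\<Otimes>\<^bsub>?G\<^esub>i\<in>{1..k}. f_sep i [^]\<^bsub>?G\<^esub> a i)" for a :: "nat \<Rightarrow> int"
  define T where "T a = (\<Otimes>\<^bsub>?G\<^esub>i\<in>{1..k}. u i [^]\<^bsub>?G\<^esub> a i)" for a :: "nat \<Rightarrow> int"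
  have rad_nilpotent: "r ^ m = 0" if "r \<in> ?rad" for r
    using power_in_ideal_power[OF that, of m] m by simp
  have f_unit: "f i \<in> Units alg_ring" if "i \<in> {1..k}" for i
    using units that by simp
  have nil: "f_nil i \<in> ?rad" and sep: "f_sep i \<in> separable_elements scale"
    and f_sep: "f_sep i = f i - f_nil i" if "i \<in> {1..k}" for i
    using step3[OF that] by (simp_all add: algebra_simps)
  have sep_unit: "f_sep i \<in> Units alg_ring" if "i \<in> {1..k}" for i
    unfolding f_sep[OF that]
    by (rule unit_minus_nilpotent(1)[OF f_unit[OF that] rad_nilpotent[OF nil[OF that]]])
  have geometric: "u i = (\<Sum>j = 0..nilpotency_index (f_nil i) - 1. ?inv (f i) ^ j * f_nil i ^ j)"
    if "i \<in> {1..k}" for i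
  proof -
    \<comment> \<open>The zeroth power is \<open>1 \<noteq> 0\<close>, which rules out \<open>m = 0\<close>.\<close>
    have "m > 0"
      using rad_nilpotent[OF nil[OF that]] by (cases m) auto
    then have "nilpotency_index (f_nil i) > 0 \<and> f_nil i ^ nilpotency_index (f_nil i) = 0"
      unfolding nilpotency_index_def
      using LeastI[of "\<lambda>j. j > 0 \<and> f_nil i ^ j = 0" m] rad_nilpotent[OF nil[OF that]] by blast
    moreover from this
    have "{0..nilpotency_index (f_nil i) - 1} = {..<nilpotency_index (f_nil i)}"
      by auto
    ultimately show ?thesis
      using unit_minus_nilpotent(2)[OF f_unit[OF that]] by (simp add: u_def f_sep[OF that])
  qed
  have u_unipotent: "u i \<in> ?W" if "i \<in> {1..k}" for i
  proof -
    have "u i = (f_sep i + f_nil i) * ?inv (f_sep i)"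
      using step3[OF that] by (simp add: u_def)
    then have "u i - 1 = f_nil i * ?inv (f_sep i)"
      using sep_unit[OF that] by (simp add: distrib_right)
    moreover have "u i \<in> Units alg_ring"
      using alg.Units_m_closed[OF f_unit[OF that] alg.Units_inv_Units[OF sep_unit[OF that]]]
      by (simp add: u_def)
    ultimately show ?thesis
      using zero_radical_closed(2)[OF nil[OF that]] by simp
  qed
  have factor: "F a = S a * T a" for a
  proof -
    have "f i = f_sep i \<otimes>\<^bsub>?G\<^esub> u i" if "i \<in> {1..k}" for i
    proof -
      have "f_sep i * u i = f i * (f_sep i * ?inv (f_sep i))"
        by (simp only: u_def mult_ac)
      then show ?thesis
        using sep_unit[OF that] by simp
    qed
    then have "F a = S a \<otimes>\<^bsub>?G\<^esub> T a"
      unfolding F_def S_def T_def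
      using sep_unit u_unipotent by (intro ug.power_product_mult) auto
    then show ?thesis
      by simp
  qed
  have T_unipotent: "T a \<in> ?W" for a
    unfolding T_def by (intro ug.power_product_in_subgroup unipotents_subgroup u_unipotent)
  have S_eq_1: "S a = 1" if "S a - 1 \<in> ?rad" for a
    unfolding S_def
  proof (rule separable_power_product_eq_1)
    show "((\<Otimes>\<^bsub>?G\<^esub>i\<in>{1..k}. f_sep i [^]\<^bsub>?G\<^esub> a i) - 1) ^ m = 0"
      using rad_nilpotent[OF that] by (simp only: S_def)
  qed (use sep sep_unit in auto)
  define c where "c i = scale ((-1) ^ (i - 1) / of_nat i) 1" for i :: nat
  have c: "of_nat i * c i = (-1) ^ (i - 1)" if "i > 0" for i
    unfolding c_def by (rule of_nat_mult_log_coeff) (use that in simp)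
  have log: "unipotent_log scale m v = trunc_log c m (v - 1)" for v
    unfolding c_def by (rule unipotent_log_eq_trunc_log)
  have log_mult: "unipotent_log scale m (v \<otimes>\<^bsub>?G\<^esub> w) = unipotent_log scale m v + unipotent_log scale m w"
    if v: "v \<in> ?W" and w: "w \<in> ?W" for v w
  proof -
    have vw: "v * w - 1 = (v - 1) + (w - 1) + (v - 1) * (w - 1)"
      by (simp add: algebra_simps)
    have "v * w - 1 \<in> ?rad"
      using subgroup.m_closed[OF unipotents_subgroup v w] by simp
    then have "trunc_log c m (v * w - 1) = trunc_log c m (v - 1) + trunc_log c m (w - 1)"
      unfolding vw using v w by (intro trunc_log_add c rad_nilpotent) auto
    then show ?thesis
      by (simp add: log)
  qed
  have log_T: "unipotent_log scale m (T a) = (\<Sum>i = 1..k. of_int (a i) * l i)" for a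
    unfolding T_def
    by (subst ug.additive_on_power_product[OF unipotents_subgroup log_mult u_unipotent])
      (simp_all add: step4 u_def)
  have log_T_iff: "(\<Sum>i = 1..k. of_int (a i) * l i) = 0 \<longleftrightarrow> T a = 1" for a
  proof
    assume "(\<Sum>i = 1..k. of_int (a i) * l i) = 0"
    then have "trunc_log c m (T a - 1) = 0"
      using log_T[of a] by (simp add: log)
    then have "T a - 1 = 0"
      using trunc_log_eq_0_imp[of c "T a - 1" m] rad_nilpotent[of "T a - 1"] T_unipotent[of a] c[of 1]
      by simp
    then show "T a = 1"
      by simp
  next
    assume "T a = 1"
    then show "(\<Sum>i = 1..k. of_int (a i) * l i) = 0"
      using log_T[of a] by (simp add: log trunc_log_0)
  qed
  have \<Lambda>: "\<Lambda> i = {a \<in> int_vecs k. F a - 1 \<in> mx i}" if "i \<in> {1..s}" for i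
  proof -
    have "maximalideal (mx i) alg_ring"
      using bij_betwE[OF step1] that by blast
    then have "ideal (mx i) alg_ring"
      by (rule maximalideal.axioms)
    then show ?thesis
      unfolding F_def step2[OF that] using f_unit by (rule exponent_lattice_Quot)
  qed
  have "?rad = (\<Inter>i\<in>{1..s}. mx i)"
    unfolding zero_radical_def using bij_betw_imp_surj_on[OF step1] by simp
  then have "M \<inter> (\<Inter>i\<in>{1..s}. \<Lambda> i) = {a \<in> int_vecs k. T a = 1 \<and> F a - 1 \<in> ?rad}"
    unfolding step5 log_T_iff using \<Lambda> by auto
  also have "\<dots> = {a \<in> int_vecs k. F a = 1}"
  proof -
    have "T a = 1 \<and> F a - 1 \<in> ?rad \<longleftrightarrow> F a = 1" for a
    proof
      assume "T a = 1 \<and> F a - 1 \<in> ?rad"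
      then show "F a = 1"
        using S_eq_1[of a] factor[of a] by auto
    next
      assume F: "F a = 1"
      then have "inv\<^bsub>?G\<^esub> T a = S a"
        using factor[of a] T_unipotent[of a]
        by (simp add: unit_group_inv inv_alg_ring_eqI mult.commute)
      then have "S a \<in> ?W"
        using subgroup.m_inv_closed[OF unipotents_subgroup T_unipotent[of a]] by simp
      then have "S a = 1"
        using S_eq_1 by simp
      moreover have "0 \<in> ?rad"
        using subgroup.one_closed[OF unipotents_subgroup[where 'r = 'r]] by simp
      ultimately show "T a = 1 \<and> F a - 1 \<in> ?rad"
        using F factor[of a] by simp
    qed
    then show ?thesis
      by simp
  qed
  also have "\<dots> = exponent_lattice ?G k f"
    by (simp add: exponent_lattice_def F_def)
  finally show ?thesis
    using geometric by (simp add: u_def)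
qed

end
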